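(* There exist a continuous surjective map $F:I^2\to I^2$ and a point $x_0\in I^2$ such that the special $\alpha$-limit set $s\alpha(x_0)\subset I^2$ of $x_0$ under $F$ is $\boldsymbol{\Sigma}^1_1$-complete.
   Context: $I^2=[0,1]\times[0,1]$ with the usual Euclidean topology, and $\mathbb{N}=\{0,1,2,\ldots\}$. For a continuous map $f:X\to X$ of a compact metric space, a backward orbit of $x\in X$ is a sequence $(x_n)_{n\in\mathbb{N}}$ in $X$ with $x_0=x$ and $f(x_{n+1})=x_n$ for all $n\in\mathbb{N}$. Its set of accumulation points, $\alpha((x_n)_{n=0}^\infty)$, is the set of all $y\in X$ such that $x_{n_i}\to y$ along some subsequence $n_i\to\infty$. The special $\alpha$-limit set of $x$ is $s\alpha(x)=\bigcup \alpha((x_n)_{n=0}^\infty)$, the union taken over all backward orbits of $x$. A subset $B$ of a Polish space $Y$ is analytic (or $\boldsymbol{\Sigma}^1_1$) if there exist a Polish space $Z$, a Borel subset $A\subset Z$, and a continuous map $g:Z\to Y$ such that $B=g(A)$. In this paper's convention, a set is called $\boldsymbol{\Sigma}^1_1$-complete if it is analytic but not Borel. *)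

theory Defs
  imports "HOL-Analysis.Analysis"
begin

definition backward_orbit :: "'a set \<Rightarrow> ('a \<Rightarrow> 'a) \<Rightarrow> 'a \<Rightarrow> (nat \<Rightarrow> 'a) \<Rightarrow> bool" where
  "backward_orbit X f x xs \<longleftrightarrow> (\<forall>n. xs n \<in> X) \<and> xs 0 = x \<and> (\<forall>n. f (xs (Suc n)) = xs n)"

text \<open>Accumulation points of a sequence are subsequential limits, not limit points of its
  range: a value taken infinitely often counts.\<close>

definition alpha_limit :: "'a::topological_space set \<Rightarrow> (nat \<Rightarrow> 'a) \<Rightarrow> 'a set" where
  "alpha_limit X xs = {y \<in> X. \<exists>r. strict_mono r \<and> (xs \<circ> r) \<longlonglongrightarrow> y}"

definition special_alpha_limit ::
    "'a::topological_space set \<Rightarrow> ('a \<Rightarrow> 'a) \<Rightarrow> 'a \<Rightarrow> 'a set" where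
  "special_alpha_limit X f x = (\<Union>xs \<in> {xs. backward_orbit X f x xs}. alpha_limit X xs)"

definition Polish_space :: "'a topology \<Rightarrow> bool" where
  "Polish_space X \<longleftrightarrow> completely_metrizable_space X \<and> separable_space X"

definition borel_in :: "'a topology \<Rightarrow> 'a set \<Rightarrow> bool" where
  "borel_in X S \<longleftrightarrow> S \<in> sigma_sets (topspace X) {U. openin X U}"

text \<open>The space \<open>Z\<close> ranges over all Polish spaces whose points belong to \<open>nat \<Rightarrow> real\<close>, with an
  arbitrary carrier and an arbitrary topology on it.  As a Polish space has at most continuum many
  points, it is homeomorphic to one of this form, so this is no restriction.  The notion is meant
  for Polish \<open>Y\<close>.\<close>

definition analytic_in :: "'a topology \<Rightarrow> 'a set \<Rightarrow> bool" where
  "analytic_in Y B \<longleftrightarrow>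
     (\<exists>(Z :: (nat \<Rightarrow> real) topology) A g.
        Polish_space Z \<and> borel_in Z A \<and> continuous_map Z Y g \<and> B = g ` A)"

text \<open>This is the convention ``analytic but not Borel'', not completeness under continuous
  reductions.\<close>

definition Sigma11_complete_in :: "'a topology \<Rightarrow> 'a set \<Rightarrow> bool" where
  "Sigma11_complete_in Y B \<longleftrightarrow> analytic_in Y B \<and> \<not> borel_in Y B"

abbreviation unit_square :: "(real \<times> real) set" where
  "unit_square \<equiv> {0..1} \<times> {0..1}"

end

theory Submission
  imports Defs
begin

text \<open>Some projection \<open>D\<close> of a closed subset \<open>Q\<close> of \<open>2\<^sup>\<omega> \<times> \<omega>\<^sup>\<omega>\<close> is not Borel, by diagonalisation.
  Coding \<open>\<omega>\<^sup>\<omega>\<close> inside a compact space turns \<open>Q\<close> into a closed set \<open>P\<close> of pairs \<open>(y, z)\<close>, where \<open>z\<close> is a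
  sequence of rows of bits and \<open>(y, z)\<close> codes a point of \<open>Q\<close> exactly if \<open>(y, z) \<in> P\<close> and each
  column of \<open>z\<close> contains a one.  In a zero-dimensional compact system, the backward orbits of a point
  correspond to the pairs in \<open>P\<close>: the orbit of \<open>(y, z)\<close> reads one row of \<open>z\<close> at a time and keeps the rows
  already read, in reverse order, as its history.  If it accumulates at \<open>y\<close> with the all-ones history,
  then every column contains a one; if every column is eventually one, it converges there.  So a
  section of the special \<open>\<alpha>\<close>-limit set is \<open>D\<close>.  Finally the system is embedded as a compact set \<open>K\<close>
  in the bottom side of the square, and the map is extended so that the height of the image is
  proportional to height plus distance to \<open>K\<close>: no point of the lower half outside \<open>K\<close> then lands on the
  bottom side, and the upper part of the square, which is backward invariant, is stretched to make
  the map surjective.\<close>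

section \<open>A non-Borel projection of a closed set\<close>

text \<open>Analyticity in a form suited to diagonalisation, since a closed set is coded by a list
  of basic open sets. All Borel sets will be shown to have this form, so a set whose complement
  lacks it is not Borel.\<close>

definition closed_projection :: "'a::topological_space set \<Rightarrow> bool" where
  "closed_projection D \<longleftrightarrow> (\<exists>Q :: ('a \<times> (nat \<Rightarrow> nat)) set. closed Q \<and> D = fst ` Q)"

lemma continuous_on_fst_apply: "continuous_on S (\<lambda>q. fst q i)"
  by (rule continuous_on_product_then_coordinatewise[OF continuous_on_fst[OF continuous_on_id]])

lemma continuous_on_snd_apply: "continuous_on S (\<lambda>q. snd q i)"
  by (rule continuous_on_product_then_coordinatewise[OF continuous_on_snd[OF continuous_on_id]])

lemma closed_projection_closed: "closed C \<Longrightarrow> closed_projection C"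
  unfolding closed_projection_def
  by (intro exI[of _ "C \<times> UNIV"]) (auto simp: closed_Times)

text \<open>Entry 0 of a witness names the index \<open>i\<close>, and its tail is a witness for
  \<open>D i\<close>.\<close>

lemma closed_projection_UN:
  assumes "\<And>i::nat. closed_projection (D i)"
  shows "closed_projection (\<Union>i. D i)"
proof -
  obtain Q :: "nat \<Rightarrow> ('a \<times> (nat \<Rightarrow> nat)) set"
    where Q: "\<And>i. closed (Q i)" "\<And>i. D i = fst ` Q i"
    using assms unfolding closed_projection_def by metis
  \<comment> \<open>Stating for each \<open>i\<close> that the head differs from \<open>i\<close> or
    the tail lies in \<open>Q i\<close> turns the choice of an index into an intersection of closed
    sets.\<close>
  define R :: "('a \<times> (nat \<Rightarrow> nat)) set"
    where "R = (\<Inter>i. (\<lambda>q. snd q 0) -` (- {i}) \<union> (\<lambda>q. (fst q, \<lambda>m. snd q (Suc m))) -` Q i)"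
  have 1: "closed ((\<lambda>q :: 'a \<times> (nat \<Rightarrow> nat). snd q 0) -` (- {i}))" for i
    by (rule closed_vimage[OF _ continuous_on_snd_apply]) (simp add: open_discrete closed_Compl)
  have 2: "closed ((\<lambda>q :: 'a \<times> (nat \<Rightarrow> nat). (fst q, \<lambda>m. snd q (Suc m))) -` Q i)" for i
    by (rule closed_vimage[OF Q(1)], rule continuous_on_Pair[OF continuous_on_fst[OF continuous_on_id]],
        rule continuous_on_coordinatewise_then_product, rule continuous_on_snd_apply)
  have "closed R"
    unfolding R_def using 1 2 by (intro closed_INT ballI closed_Un)
  moreover have "(\<Union>i. D i) = fst ` R"
  proof (intro equalityI subsetI)
    fix y assume "y \<in> (\<Union>i. D i)"
    then obtain i a where "(y, a) \<in> Q i" by (auto simp: Q)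
    then have "(y, case_nat i a) \<in> R" by (simp add: R_def)
    then show "y \<in> fst ` R" by force
  next
    fix y assume "y \<in> fst ` R"
    then obtain a where "(y, a) \<in> R" by auto
    then have "(y, \<lambda>m. a (Suc m)) \<in> Q (a 0)" by (auto simp: R_def)
    then show "y \<in> (\<Union>i. D i)" by (force simp: Q)
  qed
  ultimately show ?thesis unfolding closed_projection_def by blast
qed

text \<open>One sequence carries witnesses for all \<open>i\<close> at once, split along the pairing
  of naturals.\<close>

lemma closed_projection_INT:
  assumes "\<And>i::nat. closed_projection (D i)"
  shows "closed_projection (\<Inter>i. D i)"
proof -
  obtain Q :: "nat \<Rightarrow> ('a \<times> (nat \<Rightarrow> nat)) set"
    where Q: "\<And>i. closed (Q i)" "\<And>i. D i = fst ` Q i"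
    using assms unfolding closed_projection_def by metis
  define R :: "('a \<times> (nat \<Rightarrow> nat)) set"
    where "R = (\<Inter>i. (\<lambda>q. (fst q, \<lambda>m. snd q (prod_encode (i, m)))) -` Q i)"
  have "closed ((\<lambda>q :: 'a \<times> (nat \<Rightarrow> nat). (fst q, \<lambda>m. snd q (prod_encode (i, m)))) -` Q i)" for i
    by (rule closed_vimage[OF Q(1)], rule continuous_on_Pair[OF continuous_on_fst[OF continuous_on_id]],
        rule continuous_on_coordinatewise_then_product, rule continuous_on_snd_apply)
  then have "closed R"
    unfolding R_def by (intro closed_INT ballI)
  moreover have "(\<Inter>i. D i) = fst ` R"
  proof (intro equalityI subsetI)
    fix y assume "y \<in> (\<Inter>i. D i)"
    then have "\<forall>i. \<exists>a. (y, a) \<in> Q i" by (force simp: Q)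
    then obtain a where "\<And>i. (y, a i) \<in> Q i" by metis
    then have "(y, \<lambda>k. case prod_decode k of (i, m) \<Rightarrow> a i m) \<in> R" by (simp add: R_def)
    then show "y \<in> fst ` R" by force
  qed (force simp: Q R_def)
  ultimately show ?thesis unfolding closed_projection_def by blast
qed

text \<open>With each point the complement contains the cylinder fixed by its first \<open>n\<close>
  bits, and cylinders are open because bits are discrete.\<close>

lemma closed_determined_by_prefix:
  fixes A :: "(nat \<Rightarrow> bool) set"
  assumes "\<And>y y'. (\<And>i. i < n \<Longrightarrow> y i = y' i) \<Longrightarrow> y \<in> A \<longleftrightarrow> y' \<in> A"
  shows "closed A"
proof -
  have "\<exists>T. open T \<and> y \<in> T \<and> T \<subseteq> - A" if "y \<in> - A" for y
  proof (intro exI conjI)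
    have "open ((\<lambda>z. z i) -` {y i})" for i
      by (intro open_vimage open_discrete continuous_on_product_coordinates)
    then show "open (\<Inter>i\<in>{..<n}. (\<lambda>z. z i) -` {y i})" by (intro open_INT ballI) auto
    show "(\<Inter>i\<in>{..<n}. (\<lambda>z. z i) -` {y i}) \<subseteq> - A"
    proof
      fix z assume "z \<in> (\<Inter>i\<in>{..<n}. (\<lambda>z. z i) -` {y i})"
      then show "z \<in> - A" using assms[of y z] that by auto
    qed
  qed auto
  then show ?thesis unfolding closed_def by (subst open_subopen) blast
qed

lemma open_contains_cylinder:
  fixes U :: "(nat \<Rightarrow> bool) set"
  assumes "open U" "y \<in> U"
  obtains n where "\<And>y'. (\<And>i. i < n \<Longrightarrow> y' i = y i) \<Longrightarrow> y' \<in> U"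
proof -
  obtain X where X: "y \<in> Pi\<^sub>E UNIV X" "finite {i. X i \<noteq> UNIV}" "Pi\<^sub>E UNIV X \<subseteq> U"
    using product_topology_open_contains_basis[of "\<lambda>_. euclidean" UNIV U y] assms
    by (auto simp: open_fun_def)
  obtain n where n: "{i. X i \<noteq> UNIV} \<subseteq> {..<n}"
    using finite_nat_bounded X(2) by blast
  have "y' \<in> U" if "\<And>i. i < n \<Longrightarrow> y' i = y i" for y'
  proof -
    have "y' i \<in> X i" for i
      using that[of i] X(1) n by (cases "i < n") auto
    then show ?thesis using X(3) by auto
  qed
  then show ?thesis using that by blast
qed

text \<open>An open set is the countable union of the sets \<open>C n\<close> of points whose
  cylinder of length \<open>n\<close> lies inside it; each of these depends on \<open>n\<close> bits
  only and so is closed.\<close>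

lemma closed_projection_open:
  fixes U :: "(nat \<Rightarrow> bool) set"
  assumes "open U"
  shows "closed_projection U"
proof -
  define C where "C n = {y. \<forall>y'. (\<forall>i<n. y' i = y i) \<longrightarrow> y' \<in> U}" for n :: nat
  have "closed (C n)" for n
    by (rule closed_determined_by_prefix[of n]) (auto simp: C_def)
  then have "closed_projection (\<Union>n. C n)"
    by (intro closed_projection_UN closed_projection_closed)
  moreover have "U = (\<Union>n. C n)"
  proof (intro equalityI subsetI)
    fix y assume "y \<in> U"
    then show "y \<in> (\<Union>n. C n)"
      using open_contains_cylinder[OF assms] by (auto simp: C_def) metis
  qed (auto simp: C_def)
  ultimately show ?thesis by simp
qed

lemma closed_projection_borel:
  fixes D :: "(nat \<Rightarrow> bool) set"
  assumes "D \<in> sets borel"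
  shows "closed_projection D"
proof -
  have "D \<in> sigma_sets UNIV {U. open U}" using assms by (simp add: borel_def)
  then have "closed_projection D \<and> closed_projection (- D)"
  proof induction
    case (Basic U)
    then show ?case by (auto intro: closed_projection_open closed_projection_closed)
  next
    case (Union A)
    then show ?case by (auto simp: Compl_UN intro: closed_projection_UN closed_projection_INT)
  qed (auto simp: Compl_eq_Diff_UNIV[symmetric] intro: closed_projection_closed)
  then show ?thesis ..
qed

text \<open>Supplies the countable basis of the product space from which the codes below are
  taken.\<close>

instance bool :: second_countable_topology
proof
  have "open = generate_topology (UNIV :: bool set set)"
    by (auto simp: fun_eq_iff open_discrete intro: generate_topology.Basis)
  then show "\<exists>B :: bool set set. countable B \<and> open = generate_topology B"
    by (intro exI[of _ UNIV]) auto
qed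

text \<open>Diagonalisation: the code \<open>y\<close> of a closed set \<open>Q\<close> lists the basic open sets that \<open>Q\<close> avoids.\<close>

lemma closed_with_non_borel_projection:
  obtains Q :: "((nat \<Rightarrow> bool) \<times> (nat \<Rightarrow> nat)) set"
  where "closed Q" "fst ` Q \<notin> sets borel"
proof -
  obtain B :: "((nat \<Rightarrow> bool) \<times> (nat \<Rightarrow> nat)) set set"
    where B: "countable B" "topological_basis B"
    using ex_countable_basis by blast
  have "B \<noteq> {}"
    using topological_basisE[OF B(2) open_UNIV] by blast
  define N where "N = from_nat_into B"
  have rN: "range N = B"
    using B \<open>B \<noteq> {}\<close> by (simp add: N_def range_from_nat_into)
  define Q where "Q = (\<Inter>i. {q. \<not> fst q i} \<union> - N i)"
  have Q_iff: "q \<in> Q \<longleftrightarrow> (\<forall>i. fst q i \<longrightarrow> q \<notin> N i)" for q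
    unfolding Q_def by blast
  have "open ((\<lambda>q :: (nat \<Rightarrow> bool) \<times> (nat \<Rightarrow> nat). fst q i) -` {True})" for i
    by (intro open_vimage open_discrete continuous_on_fst_apply)
  moreover have "{q :: (nat \<Rightarrow> bool) \<times> (nat \<Rightarrow> nat). \<not> fst q i} = - ((\<lambda>q. fst q i) -` {True})" for i
    by auto
  ultimately have "closed {q :: (nat \<Rightarrow> bool) \<times> (nat \<Rightarrow> nat). \<not> fst q i}" for i
    by (simp add: closed_Compl)
  moreover have "open (N i)" for i
    using B(2) rN by (metis rangeI topological_basis_open)
  ultimately have "closed Q"
    unfolding Q_def by (intro closed_INT ballI closed_Un closed_Compl)
  moreover have "fst ` Q \<notin> sets borel"
  proof
    assume "fst ` Q \<in> sets borel"
    then have "- (fst ` Q) \<in> sets borel" by auto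
    then have "closed_projection (- (fst ` Q))"
      by (rule closed_projection_borel)
    then obtain P :: "((nat \<Rightarrow> bool) \<times> (nat \<Rightarrow> nat)) set"
      where P: "closed P" "- (fst ` Q) = fst ` P"
      unfolding closed_projection_def by (elim exE conjE)
    \<comment> \<open>The code of \<open>P\<close>: being closed, \<open>P\<close> consists of the
      points that avoid every basic open set listed by \<open>y\<close>.\<close>
    define y where "y i \<longleftrightarrow> N i \<inter> P = {}" for i
    have P_iff: "q \<in> P \<longleftrightarrow> (\<forall>i. y i \<longrightarrow> q \<notin> N i)" for q
    proof
      assume R: "\<forall>i. y i \<longrightarrow> q \<notin> N i"
      show "q \<in> P"
      proof (rule ccontr)
        assume "q \<notin> P"
        then obtain V where "V \<in> B" "q \<in> V" "V \<subseteq> - P"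
          using topological_basisE[OF B(2), of "- P" q] P(1) by (metis ComplI open_Compl)
        then show False using R rN by (auto simp: y_def)
      qed
    qed (auto simp: y_def)
    \<comment> \<open>Over the point \<open>y\<close> itself \<open>P\<close> and \<open>Q\<close>
      have the same section, although their projections are complementary.\<close>
    have "y \<in> fst ` P \<longleftrightarrow> (\<exists>a. \<forall>i. y i \<longrightarrow> (y, a) \<notin> N i)"
      by (simp add: image_iff Bex_def P_iff)
    also have "\<dots> \<longleftrightarrow> y \<in> fst ` Q"
      by (simp add: image_iff Bex_def Q_iff)
    finally show False using P(2) by (metis ComplD ComplI)
  qed
  ultimately show ?thesis using that by blast
qed

section \<open>Special limit sets are analytic\<close>

text \<open>Trades the quantifier over subsequences for quantifiers over naturals, which makes
  accumulation a Borel condition.\<close>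

lemma accumulation_iff_dist:
  fixes xs :: "nat \<Rightarrow> 'a::metric_space"
  shows "(\<exists>r. strict_mono r \<and> (xs \<circ> r) \<longlonglongrightarrow> y)
    \<longleftrightarrow> (\<forall>k. \<exists>n\<ge>k. dist (xs n) y < inverse (real (Suc k)))"
proof
  assume "\<exists>r. strict_mono r \<and> (xs \<circ> r) \<longlonglongrightarrow> y"
  then obtain r where r: "strict_mono r" "(xs \<circ> r) \<longlonglongrightarrow> y" by blast
  show "\<forall>k. \<exists>n\<ge>k. dist (xs n) y < inverse (real (Suc k))"
  proof
    fix k
    obtain N where "\<And>n. n \<ge> N \<Longrightarrow> dist (xs (r n)) y < inverse (real (Suc k))"
      using metric_LIMSEQ_D[OF r(2), of "inverse (real (Suc k))"] by auto
    moreover have "r (max N k) \<ge> k"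
      using seq_suble[OF r(1), of "max N k"] by simp
    ultimately show "\<exists>n\<ge>k. dist (xs n) y < inverse (real (Suc k))"
      by (meson max.cobounded1)
  qed
next
  assume *: "\<forall>k. \<exists>n\<ge>k. dist (xs n) y < inverse (real (Suc k))"
  \<comment> \<open>The index \<open>max k (Suc n)\<close> secures the precision and the strict
    growth at the same time.\<close>
  have step: "\<exists>m. dist (xs m) y < inverse (real (Suc k)) \<and> n < m" for n k
  proof -
    obtain m where "m \<ge> max k (Suc n)" "dist (xs m) y < inverse (real (Suc (max k (Suc n))))"
      using * by blast
    moreover have "inverse (real (Suc (max k (Suc n)))) \<le> inverse (real (Suc k))"
      by (intro le_imp_inverse_le) auto
    ultimately show ?thesis by (intro exI[of _ m] conjI) linarith+
  qed
  have "\<exists>r. \<forall>k. dist (xs (r k)) y < inverse (real (Suc k)) \<and> r k < r (Suc k)"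
    by (rule dependent_nat_choice) (use step in blast)+
  then obtain r where r: "\<And>k. dist (xs (r k)) y < inverse (real (Suc k))" "\<And>k. r k < r (Suc k)"
    by blast
  have "(\<lambda>k. dist (xs (r k)) y) \<longlonglongrightarrow> 0"
    by (rule real_tendsto_sandwich[OF _ _ tendsto_const LIMSEQ_inverse_real_of_nat])
      (simp_all only: zero_le_dist less_imp_le[OF r(1)] eventually_True)
  then have "(xs \<circ> r) \<longlonglongrightarrow> y"
    by (subst tendsto_dist_iff) (simp add: o_def)
  then show "\<exists>r. strict_mono r \<and> (xs \<circ> r) \<longlonglongrightarrow> y"
    using r(2) by (auto simp: strict_mono_Suc_iff)
qed

lemma Polish_space_euclidean: "Polish_space (euclidean :: 'a::polish_space topology)"
proof -
  obtain D :: "'a set" where "countable D" "\<And>X. open X \<Longrightarrow> X \<noteq> {} \<Longrightarrow> \<exists>d\<in>D. d \<in> X"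
    using countable_dense_setE by blast
  moreover have "euclidean closure_of D = topspace euclidean"
    unfolding dense_intersects_open using calculation(2) by (simp add: disjoint_iff) blast
  ultimately have "separable_space (euclidean :: 'a topology)"
    unfolding separable_space_def by (intro exI[of _ D] conjI) simp_all
  then show ?thesis
    by (simp add: Polish_space_def completely_metrizable_space_euclidean)
qed

text \<open>A sequence of reals codes a candidate limit \<open>pt 0\<close> followed by a candidate
  orbit \<open>pt 1\<close>, \<open>pt 2\<close> and so on. Being an orbit is a closed condition and
  accumulating at \<open>pt 0\<close> a G-delta one, so the limit set is a continuous image of a
  Borel set.\<close>

lemma analytic_special_alpha_limit:
  assumes F: "continuous_on unit_square F"
  shows "analytic_in (top_of_set unit_square) (special_alpha_limit unit_square F x)"
proof -
  \<comment> \<open>Clamping lets every sequence code points of the square, so \<open>pt n\<close>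
    is continuous on the whole Polish space.\<close>
  define clamp :: "real \<Rightarrow> real" where "clamp t = max 0 (min 1 t)" for t
  define pt :: "nat \<Rightarrow> (nat \<Rightarrow> real) \<Rightarrow> real \<times> real"
    where "pt n u = (clamp (u (2 * n)), clamp (u (2 * n + 1)))" for n u
  define A where "A = {u. pt 1 u = x} \<inter> (\<Inter>n. {u. F (pt (n + 2) u) = pt (n + 1) u})
      \<inter> (\<Inter>k. \<Union>n\<in>{k..}. {u. dist (pt (n + 1) u) (pt 0 u) < inverse (real (Suc k))})"
  have pt_in: "pt n u \<in> unit_square" for n u
    by (simp add: pt_def clamp_def)
  have pt_cont: "continuous_on UNIV (pt n)" for n
    unfolding pt_def clamp_def by (intro continuous_intros continuous_on_product_coordinates)
  have F_cont: "continuous_on UNIV (\<lambda>u. F (pt n u))" for n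
    by (rule continuous_on_compose2[OF F pt_cont]) (intro image_subsetI pt_in)
  have "closed {u. pt 1 u = x}" "closed (\<Inter>n. {u. F (pt (n + 2) u) = pt (n + 1) u})"
    by (intro closed_INT ballI closed_Collect_eq pt_cont F_cont continuous_on_const)+
  moreover have "open (\<Union>n\<in>{k..}. {u. dist (pt (n + 1) u) (pt 0 u) < inverse (real (Suc k))})" for k
    by (intro open_UN ballI open_Collect_less continuous_on_dist pt_cont continuous_on_const)
  then have "(\<Inter>k. \<Union>n\<in>{k..}. {u. dist (pt (n + 1) u) (pt 0 u) < inverse (real (Suc k))}) \<in> sets borel"
    by (intro sets.countable_INT'' borel_open) simp_all
  ultimately have "A \<in> sets borel"
    unfolding A_def by (intro sets.Int) (simp_all only: borel_closed)
  then have "borel_in euclidean A"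
    by (simp add: borel_in_def borel_def)
  moreover have "continuous_map euclidean (top_of_set unit_square) (pt 0)"
    using pt_cont pt_in by (auto simp: continuous_map_in_subtopology)
  moreover have "special_alpha_limit unit_square F x = pt 0 ` A"
  proof (intro equalityI subsetI)
    fix q assume "q \<in> special_alpha_limit unit_square F x"
    then obtain xs where xs: "\<And>n. xs n \<in> unit_square" "xs 0 = x" "\<And>n. F (xs (Suc n)) = xs n"
      and q: "q \<in> unit_square" "\<And>k. \<exists>n\<ge>k. dist (xs n) q < inverse (real (Suc k))"
      unfolding special_alpha_limit_def alpha_limit_def backward_orbit_def accumulation_iff_dist
      by blast
    define ys where "ys = case_nat q xs"
    define u where "u m = (if even m then fst (ys (m div 2)) else snd (ys (m div 2)))" for m
    have ys: "ys n \<in> unit_square" for n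
      using xs(1) q(1) by (cases n) (simp_all only: ys_def nat.case)
    have pt: "pt n u = ys n" for n
      using ys[of n] unfolding pt_def u_def clamp_def mem_Times_iff by (simp add: prod_eq_iff)
    have "pt 1 u = x" by (simp add: pt ys_def xs(2))
    moreover have "F (pt (n + 2) u) = pt (n + 1) u" for n by (simp add: pt ys_def xs(3))
    moreover have "\<exists>n\<ge>k. dist (pt (n + 1) u) (pt 0 u) < inverse (real (Suc k))" for k
      using q(2)[of k] by (simp add: pt ys_def)
    ultimately have "u \<in> A" unfolding A_def by blast
    moreover have "pt 0 u = q" by (simp add: pt ys_def)
    ultimately show "q \<in> pt 0 ` A" by blast
  next
    fix q assume "q \<in> pt 0 ` A"
    then obtain u where "u \<in> A" "q = pt 0 u" by blast
    then have u: "pt 1 u = x" "\<And>n. F (pt (n + 2) u) = pt (n + 1) u"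
      "\<And>k. \<exists>n\<ge>k. dist (pt (n + 1) u) q < inverse (real (Suc k))"
      unfolding A_def by blast+
    from u(1,2) have "backward_orbit unit_square F x (\<lambda>n. pt (n + 1) u)"
      unfolding backward_orbit_def using pt_in by simp
    moreover from u(3) have "q \<in> alpha_limit unit_square (\<lambda>n. pt (n + 1) u)"
      unfolding alpha_limit_def accumulation_iff_dist using pt_in \<open>q = pt 0 u\<close> by blast
    ultimately show "q \<in> special_alpha_limit unit_square F x"
      unfolding special_alpha_limit_def by blast
  qed
  ultimately show ?thesis
    unfolding analytic_in_def using Polish_space_euclidean by blast
qed

section \<open>From the line to the square\<close>

text \<open>Conjugation carries orbits and limits over. Compactness of the domain makes the inverse
  continuous on the range, which brings convergence back.\<close>

lemma special_alpha_limit_image: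
  fixes e :: "'a::topological_space \<Rightarrow> 'b::t2_space"
  assumes e: "continuous_on UNIV e" "inj e" and "compact (UNIV :: 'a set)"
  shows "e y \<in> special_alpha_limit (e ` X) (e \<circ> f \<circ> inv e) (e x) \<longleftrightarrow> y \<in> special_alpha_limit X f x"
proof
  assume "y \<in> special_alpha_limit X f x"
  then obtain xs r where xs: "\<And>n. xs n \<in> X" "xs 0 = x" "\<And>n. f (xs (Suc n)) = xs n"
    and r: "y \<in> X" "strict_mono r" "(xs \<circ> r) \<longlonglongrightarrow> y"
    unfolding special_alpha_limit_def alpha_limit_def backward_orbit_def by blast
  have "backward_orbit (e ` X) (e \<circ> f \<circ> inv e) (e x) (e \<circ> xs)"
    unfolding backward_orbit_def using xs by (simp add: inv_f_f[OF e(2)])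
  moreover have "((e \<circ> xs) \<circ> r) \<longlonglongrightarrow> e y"
    using continuous_on_tendsto_compose[OF e(1) r(3)] by (simp add: o_def)
  ultimately show "e y \<in> special_alpha_limit (e ` X) (e \<circ> f \<circ> inv e) (e x)"
    unfolding special_alpha_limit_def alpha_limit_def using r by blast
next
  assume "e y \<in> special_alpha_limit (e ` X) (e \<circ> f \<circ> inv e) (e x)"
  then obtain zs r where zs: "\<And>n. zs n \<in> e ` X" "zs 0 = e x"
      "\<And>n. e (f (inv e (zs (Suc n)))) = zs n"
    and r: "e y \<in> e ` X" "strict_mono r" "(zs \<circ> r) \<longlonglongrightarrow> e y"
    unfolding special_alpha_limit_def alpha_limit_def backward_orbit_def by auto
  define xs where "xs n = inv e (zs n)" for n
  have e_xs: "e (xs n) = zs n" and xs_X: "xs n \<in> X" for n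
    using zs(1)[of n] by (auto simp: xs_def inv_f_f[OF e(2)])
  have "backward_orbit X f x xs"
    unfolding backward_orbit_def
    using xs_X e_xs zs(2,3) e(2) by (metis injD xs_def)
  moreover have "continuous_on (range e) (inv e)"
    using e assms(3) by (intro continuous_on_inv) (auto simp: inv_f_f)
  then have "(\<lambda>n. inv e ((zs \<circ> r) n)) \<longlonglongrightarrow> inv e (e y)"
    by (rule continuous_on_tendsto_compose[OF _ r(3)])
      (auto simp: e_xs[symmetric] intro!: always_eventually)
  then have "(xs \<circ> r) \<longlonglongrightarrow> y"
    by (simp add: xs_def[symmetric] o_def inv_f_f[OF e(2)])
  moreover have "y \<in> X" using r(1) e(2) by (auto dest: injD)
  ultimately show "y \<in> special_alpha_limit X f x"
    unfolding special_alpha_limit_def alpha_limit_def using r(2) by blast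
qed

text \<open>A backward orbit whose heights accumulate at 0 never enters the upper half, and in the
  lower half an image of height 0 forces height 0 and membership in \<open>K\<close>.\<close>

lemma planar_extension:
  fixes g :: "real \<Rightarrow> real"
  assumes K: "compact K" "K \<noteq> {}" "K \<subseteq> {0..1}"
    and g: "continuous_on K g" "g ` K \<subseteq> {0..1}"
  obtains F where "continuous_on unit_square F" "F ` unit_square = unit_square"
    "\<And>x z. x \<in> K \<Longrightarrow>
      (z, 0) \<in> special_alpha_limit unit_square F (x, 0) \<longleftrightarrow> z \<in> special_alpha_limit K g x"
proof -
  obtain G where G: "continuous_on UNIV G" "\<And>x. x \<in> K \<Longrightarrow> G x = g x" "\<And>x. G x \<in> {0..1}"
    using Tietze_closed_interval_1[of K g UNIV 0 1] K g compact_imp_closed[OF K(1)]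
    by (auto simp: image_subset_iff)
  \<comment> \<open>\<open>a\<close> is 0 up to height 1 / 2 and 1 from height 3 / 4 on, so
    \<open>F\<close> blends the lower formula into a vertical stretching of the top quarter onto the
    whole square.\<close>
  define a :: "real \<Rightarrow> real" where "a t = max 0 (min 1 (4 * t - 2))" for t
  define F :: "real \<times> real \<Rightarrow> real \<times> real" where
    "F p = ((1 - a (snd p)) * G (fst p) + a (snd p) * fst p,
      (1 - a (snd p)) * ((infdist (fst p) K + snd p) / 4) + max 0 (4 * snd p - 3))" for p
  have "continuous_on UNIV (\<lambda>p :: real \<times> real. G (fst p))"
    by (rule continuous_on_compose2[OF G(1)]) (auto intro: continuous_intros)
  then have F_cont: "continuous_on unit_square F"
    unfolding F_def a_def
    by (intro continuous_intros) (auto elim: continuous_on_subset)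
  have F_low: "F (x, t) = (G x, (infdist x K + t) / 4)" if "t \<le> 1 / 2" for x t
    using that by (simp add: F_def a_def)
  have F_high: "F (x, t) = (x, 4 * t - 3)" if "t \<ge> 3 / 4" for x t
    using that by (simp add: F_def a_def)
  have dist_K: "infdist x K \<in> {0..1}" if "x \<in> {0..1}" for x
  proof -
    obtain k where "k \<in> K" using K(2) by blast
    then have "infdist x K \<le> dist x k" "k \<in> {0..1}" using K(3) by (auto intro: infdist_le)
    then show ?thesis using that by (auto simp: dist_real_def infdist_nonneg)
  qed
  have a_range: "0 \<le> a t" "a t \<le> 1" for t by (auto simp: a_def)
  have F_in: "F (x, t) \<in> unit_square" if x: "x \<in> {0..1}" and t: "t \<in> {0..1}" for x t
  proof -
    have "(1 - a t) *\<^sub>R G x + a t *\<^sub>R x \<in> {0..1}"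
      by (rule convexD_alt[OF convex_real_interval(5) G(3) x a_range])
    then have 1: "fst (F (x, t)) \<in> {0..1}" by (simp add: F_def)
    have 2: "snd (F (x, t)) \<in> {0..1}"
    proof (cases "t \<ge> 3 / 4")
      case True
      then show ?thesis using t by (simp add: F_high)
    next
      case False
      have "(1 - a t) * ((infdist x K + t) / 4) \<le> 1 * 1"
        using a_range[of t] dist_K[OF x] t by (intro mult_mono) auto
      moreover have "0 \<le> (1 - a t) * ((infdist x K + t) / 4)"
        using a_range[of t] dist_K[OF x] t by (intro mult_nonneg_nonneg) auto
      ultimately show ?thesis using False by (simp add: F_def)
    qed
    show ?thesis using 1 2 by (simp add: mem_Times_iff)
  qed
  have F_surj: "F ` unit_square = unit_square"
  proof (intro equalityI subsetI)
    fix q assume q: "q \<in> unit_square"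
    then have "F (fst q, (snd q + 3) / 4) = q" "(fst q, (snd q + 3) / 4) \<in> unit_square"
      by (auto simp: F_high mem_Times_iff prod_eq_iff field_simps)
    then show "q \<in> F ` unit_square" by (metis imageI)
  next
    fix q assume "q \<in> F ` unit_square"
    then obtain p where "p \<in> unit_square" "q = F p" by blast
    then show "q \<in> unit_square"
      using F_in[of "fst p" "snd p"] by (simp add: mem_Times_iff)
  qed
  have alpha: "(z, 0) \<in> special_alpha_limit unit_square F (x, 0) \<longleftrightarrow> z \<in> special_alpha_limit K g x"
    if x: "x \<in> K" for x z
  proof
    assume "z \<in> special_alpha_limit K g x"
    then obtain xs r where xs: "\<And>n. xs n \<in> K" "xs 0 = x" "\<And>n. g (xs (Suc n)) = xs n"
      and r: "z \<in> K" "strict_mono r" "(xs \<circ> r) \<longlonglongrightarrow> z"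
      unfolding special_alpha_limit_def alpha_limit_def backward_orbit_def by blast
    have "backward_orbit unit_square F (x, 0) (\<lambda>n. (xs n, 0))"
      using xs(1) K(3) by (auto simp: backward_orbit_def F_low G(2) xs(2,3) subset_iff)
    moreover have "((\<lambda>n. (xs n, 0::real)) \<circ> r) \<longlonglongrightarrow> (z, 0)"
      using tendsto_Pair[OF r(3) tendsto_const[of "0::real"]] by (simp add: o_def)
    moreover have "(z, 0) \<in> unit_square" using r(1) K(3) by auto
    ultimately show "(z, 0) \<in> special_alpha_limit unit_square F (x, 0)"
      unfolding special_alpha_limit_def alpha_limit_def using r(2) by blast
  next
    assume "(z, 0) \<in> special_alpha_limit unit_square F (x, 0)"
    then obtain ps r where ps: "\<And>n. ps n \<in> unit_square" "ps 0 = (x, 0)"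
        "\<And>n. F (ps (Suc n)) = ps n"
      and r: "strict_mono r" "(ps \<circ> r) \<longlonglongrightarrow> (z, 0)"
      unfolding special_alpha_limit_def alpha_limit_def backward_orbit_def by blast
    \<comment> \<open>A point of height below 1 / 2 has an image of height below (1 + 1 / 2) / 4,
      hence below 1 / 2.\<close>
    have up: "snd (ps (Suc n)) \<ge> 1 / 2" if "snd (ps n) \<ge> 1 / 2" for n
    proof (rule ccontr)
      assume low: "\<not> snd (ps (Suc n)) \<ge> 1 / 2"
      have "snd (ps n) = (infdist (fst (ps (Suc n))) K + snd (ps (Suc n))) / 4"
        using low F_low[of "snd (ps (Suc n))" "fst (ps (Suc n))"] ps(3)[of n] by auto
      moreover have "infdist (fst (ps (Suc n))) K \<le> 1"
        using dist_K[of "fst (ps (Suc n))"] ps(1)[of "Suc n"] by (auto simp: mem_Times_iff)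
      ultimately show False using low that by simp
    qed
    have low: "snd (ps n) < 1 / 2" for n
    proof (rule ccontr)
      assume "\<not> snd (ps n) < 1 / 2"
      then have "snd (ps (n + m)) \<ge> 1 / 2" for m
      proof (induction m)
        case (Suc m)
        then show ?case using up[of "n + m"] by simp
      qed simp
      then have "snd ((ps \<circ> r) m) \<ge> 1 / 2" if "m \<ge> n" for m
        using that seq_suble[OF r(1), of m] by (metis comp_apply le_add_diff_inverse le_trans)
      moreover have "(\<lambda>m. snd ((ps \<circ> r) m)) \<longlonglongrightarrow> snd (z, 0::real)"
        by (rule tendsto_snd[OF r(2)])
      ultimately have "1 / 2 \<le> snd (z, 0::real)"
        by (intro LIMSEQ_le_const) auto
      then show False by simp
    qed
    \<comment> \<open>The height of the image is a sum of nonnegative terms, so if it vanishes both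
      terms do; and \<open>K\<close> is closed.\<close>
    have line: "snd (ps n) = 0 \<and> fst (ps n) \<in> K" for n
    proof (induction n)
      case 0
      then show ?case using ps(2) x by simp
    next
      case (Suc n)
      have "snd (ps n) = (infdist (fst (ps (Suc n))) K + snd (ps (Suc n))) / 4"
        using low[of "Suc n"] F_low[of "snd (ps (Suc n))" "fst (ps (Suc n))"] ps(3)[of n] by auto
      moreover have "0 \<le> snd (ps (Suc n))"
        using ps(1)[of "Suc n"] by (auto simp: mem_Times_iff)
      ultimately have "infdist (fst (ps (Suc n))) K = 0 \<and> snd (ps (Suc n)) = 0"
        using conjunct1[OF Suc.IH] infdist_nonneg[of "fst (ps (Suc n))" K]
        by (simp add: add_nonneg_eq_0_iff)
      then show ?case
        using in_closed_iff_infdist_zero[OF compact_imp_closed[OF K(1)] K(2)] by simp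
    qed
    define xs where "xs n = fst (ps n)" for n
    have xs: "ps n = (xs n, 0)" "xs n \<in> K" for n
      using line[of n] by (simp_all add: xs_def prod_eq_iff)
    have "g (xs (Suc n)) = xs n" for n
      using ps(3)[of n] xs(2)[of "Suc n"] by (simp add: xs(1) F_low G(2))
    then have "backward_orbit K g x xs"
      using ps(2) xs(2) by (simp add: backward_orbit_def xs_def)
    moreover have lim: "(xs \<circ> r) \<longlonglongrightarrow> z"
      using tendsto_fst[OF r(2)] by (simp add: o_def xs_def)
    moreover have "z \<in> K"
      by (rule closed_sequentially[OF compact_imp_closed[OF K(1)] _ lim]) (simp add: xs(2))
    ultimately show "z \<in> special_alpha_limit K g x"
      unfolding special_alpha_limit_def alpha_limit_def using r(1) by blast
  qed
  show ?thesis by (rule that[OF F_cont F_surj alpha])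
qed

section \<open>The symbolic system\<close>

lemma compact_UNIV_fun:
  assumes "compact (UNIV :: 'b::topological_space set)"
  shows "compact (UNIV :: ('a \<Rightarrow> 'b) set)"
  using compactin_PiE[of "\<lambda>_. euclidean" "UNIV :: 'a set" "\<lambda>_. UNIV :: 'b set"] assms
  by (simp add: euclidean_product_topology)

lemma tendsto_fun:
  fixes f :: "'c \<Rightarrow> 'a \<Rightarrow> 'b::topological_space"
  assumes "\<And>i. ((\<lambda>x. f x i) \<longlongrightarrow> l i) F"
  shows "(f \<longlongrightarrow> l) F"
  using limitin_componentwise[of "\<lambda>_. euclidean" "UNIV :: 'a set" f l F] assms
  by (simp add: euclidean_product_topology)

lemma tendsto_fun_apply:
  fixes f :: "'c \<Rightarrow> 'a \<Rightarrow> 'b::topological_space"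
  assumes "(f \<longlongrightarrow> l) F"
  shows "((\<lambda>x. f x i) \<longlongrightarrow> l i) F"
  by (rule continuous_on_tendsto_compose[OF continuous_on_product_coordinates assms]) auto

lemma clopen_Collect_bool:
  fixes b :: "'a::topological_space \<Rightarrow> bool"
  assumes "continuous_on UNIV b"
  shows "open {x. b x}" "closed {x. b x}"
proof -
  have "open (b -` {True})" "open (b -` {False})"
    by (rule open_vimage[OF open_discrete assms])+
  moreover have "b -` {True} = {x. b x}" "- (b -` {False}) = {x. b x}" by auto
  ultimately show "open {x. b x}" "closed {x. b x}" by (metis closed_Compl)+
qed

text \<open>The two branches live on disjoint clopen sets, so they glue without any matching
  condition.\<close>

lemma continuous_on_If_bool:
  fixes b :: "'a::topological_space \<Rightarrow> bool"
  assumes b: "continuous_on UNIV b" and "continuous_on UNIV f" "continuous_on UNIV g"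
  shows "continuous_on UNIV (\<lambda>x. if b x then f x else g x)"
proof -
  have "closed {x. \<not> b x}"
    using clopen_Collect_bool(1)[OF b] by (simp add: closed_def Compl_eq)
  then have "continuous_on ({x. b x} \<union> {x. \<not> b x}) (\<lambda>x. if b x then f x else g x)"
    using assms clopen_Collect_bool(2)[OF b]
    by (intro continuous_on_cases) (auto elim: continuous_on_subset)
  moreover have "{x. b x} \<union> {x. \<not> b x} = UNIV" by auto
  ultimately show ?thesis by simp
qed

section \<open>States and the map on them\<close>

type_synonym state = "(nat \<Rightarrow> bool) \<times> (nat \<Rightarrow> nat \<Rightarrow> bool) \<times> (nat \<Rightarrow> nat \<Rightarrow> bool)"

text \<open>A state \<open>(y, p, v)\<close> of level \<open>n\<close> stands for \<open>n\<close> rows of \<open>z\<close> having been read.  Column \<open>0\<close> of \<open>v\<close>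
  vanishes in its first \<open>n\<close> rows, row \<open>n\<close> marks the level, and \<open>z\<close> follows; so row \<open>k\<close> of \<open>z\<close> is
  \<open>v (n + 1 + k)\<close>, and the history \<open>p i = z (n - 1 - i)\<close> is \<open>v (2 * n - i)\<close>.  The states without a
  level, where \<open>z\<close> has been forgotten, are the limits.\<close>

definition at_level :: "nat \<Rightarrow> (nat \<Rightarrow> nat \<Rightarrow> bool) \<Rightarrow> bool" where
  "at_level n v \<longleftrightarrow> (\<forall>i<n. \<not> v i 0) \<and> v n 0"

definition rev_prefix :: "nat \<Rightarrow> (nat \<Rightarrow> nat \<Rightarrow> bool) \<Rightarrow> nat \<Rightarrow> nat \<Rightarrow> bool" where
  "rev_prefix n v i = (if i < n then v (2 * n - i) else (\<lambda>_. False))"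

text \<open>The full history separates the root from the regular states of level 0, whose history is
  empty; \<open>step\<close> tells them apart by the bit \<open>p 0 0\<close>.\<close>

definition root_state :: state where
  "root_state = ((\<lambda>_. False), (\<lambda>_ _. True), (\<lambda>_ _. True))"

definition regular_states :: "((nat \<Rightarrow> bool) \<times> (nat \<Rightarrow> nat \<Rightarrow> bool)) set \<Rightarrow> state set" where
  "regular_states P = {(y, p, v). \<forall>n. at_level n v \<longrightarrow>
     (y, \<lambda>i. v (n + 1 + i)) \<in> P \<and> p = rev_prefix n v}"

text \<open>As \<open>root_state\<close> has a level without being regular, it is sent away from itself, to the zero state,
  lest it be its own preimage.\<close>

definition step :: "state \<Rightarrow> state" where
  "step = (\<lambda>(y, p, v). if v 0 0
     then if p 0 0 then ((\<lambda>_. False), (\<lambda>_ _. False), (\<lambda>_ _. False)) else root_state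
     else (y, \<lambda>i. p (Suc i), \<lambda>i. v (Suc i)))"

text \<open>The limit of an orbit along which every column of \<open>z\<close> is eventually one:
  the level has moved off to infinity and the history has filled with ones.\<close>

definition target :: "(nat \<Rightarrow> bool) \<Rightarrow> state" where
  "target y = (y, (\<lambda>_ _. True), (\<lambda>_ _. False))"

lemma compact_UNIV_state: "compact (UNIV :: state set)"
proof -
  have "compact (UNIV :: bool set)" by (rule finite_imp_compact) simp
  then have "compact (UNIV \<times> UNIV \<times> UNIV :: state set)"
    by (intro compact_Times compact_UNIV_fun)
  then show ?thesis by simp
qed

lemma continuous_on_state_coordinates:
  "continuous_on UNIV (\<lambda>s :: state. fst s i)"
  "continuous_on UNIV (\<lambda>s :: state. fst (snd s) i)"
  "continuous_on UNIV (\<lambda>s :: state. snd (snd s) i)"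
  "continuous_on UNIV (\<lambda>s :: state. fst (snd s) i j)"
  "continuous_on UNIV (\<lambda>s :: state. snd (snd s) i j)"
proof -
  show 1: "continuous_on UNIV (\<lambda>s :: state. fst s i)"
    by (rule continuous_on_fst_apply)
  show 2: "continuous_on UNIV (\<lambda>s :: state. fst (snd s) i)"
    by (rule continuous_on_product_then_coordinatewise)
      (rule continuous_on_fst[OF continuous_on_snd[OF continuous_on_id]])
  show 3: "continuous_on UNIV (\<lambda>s :: state. snd (snd s) i)"
    by (rule continuous_on_product_then_coordinatewise)
      (rule continuous_on_snd[OF continuous_on_snd[OF continuous_on_id]])
  show "continuous_on UNIV (\<lambda>s :: state. fst (snd s) i j)"
    by (rule continuous_on_product_then_coordinatewise[OF 2])
  show "continuous_on UNIV (\<lambda>s :: state. snd (snd s) i j)"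
    by (rule continuous_on_product_then_coordinatewise[OF 3])
qed

lemma continuous_on_step: "continuous_on UNIV step"
proof -
  have "continuous_on UNIV (\<lambda>s :: state. if snd (snd s) 0 0
     then if fst (snd s) 0 0 then ((\<lambda>_. False), (\<lambda>_ _. False), (\<lambda>_ _. False)) else root_state
     else (fst s, \<lambda>i. fst (snd s) (Suc i), \<lambda>i. snd (snd s) (Suc i)))"
    by (intro continuous_on_If_bool continuous_on_state_coordinates continuous_on_const
        continuous_on_Pair continuous_on_fst[OF continuous_on_id])
      (rule continuous_on_coordinatewise_then_product, rule continuous_on_state_coordinates)+
  then show ?thesis by (simp add: step_def case_prod_beta')
qed

text \<open>Having level \<open>n\<close> is an open condition and what it implies is closed, so
  each implication defines a closed set.\<close>

lemma closed_regular_states: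
  assumes "closed P"
  shows "closed (regular_states P)"
proof -
  have "open {s :: state. at_level n (snd (snd s))}" for n
  proof -
    have "closed {s :: state. snd (snd s) i 0}" for i
      by (rule clopen_Collect_bool(2)[OF continuous_on_state_coordinates(5)])
    then have "open (\<Inter>i\<in>{..<n}. {s :: state. \<not> snd (snd s) i 0})"
      by (intro open_INT ballI) (simp_all add: open_Collect_neg)
    moreover have "open {s :: state. snd (snd s) n 0}"
      by (rule clopen_Collect_bool(1)[OF continuous_on_state_coordinates(5)])
    ultimately have "open ((\<Inter>i\<in>{..<n}. {s :: state. \<not> snd (snd s) i 0}) \<inter> {s. snd (snd s) n 0})"
      by (rule open_Int)
    moreover have "(\<Inter>i\<in>{..<n}. {s :: state. \<not> snd (snd s) i 0}) \<inter> {s. snd (snd s) n 0}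
        = {s. at_level n (snd (snd s))}"
      unfolding at_level_def by blast
    ultimately show ?thesis by simp
  qed
  moreover have "closed {s :: state. (fst s, \<lambda>i. snd (snd s) (n + 1 + i)) \<in> P}" for n
  proof -
    have "closed ((\<lambda>s :: state. (fst s, \<lambda>i. snd (snd s) (n + 1 + i))) -` P)"
      by (rule closed_vimage[OF assms],
          rule continuous_on_Pair[OF continuous_on_fst[OF continuous_on_id]],
          rule continuous_on_coordinatewise_then_product, rule continuous_on_state_coordinates)
    then show ?thesis by (simp only: vimage_def)
  qed
  moreover have "closed {s :: state. fst (snd s) = rev_prefix n (snd (snd s))}" for n
  proof -
    have "continuous_on UNIV (\<lambda>s :: state. rev_prefix n (snd (snd s)) i j)" for i j
      by (cases "i < n") (simp_all add: rev_prefix_def continuous_on_state_coordinates)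
    then have "closed {s :: state. fst (snd s) i j = rev_prefix n (snd (snd s)) i j}" for i j
      by (intro closed_Collect_eq continuous_on_state_coordinates)
    then have "closed {s :: state. \<forall>i j. fst (snd s) i j = rev_prefix n (snd (snd s)) i j}"
      by (intro closed_Collect_all)
    then show ?thesis by (simp only: fun_eq_iff)
  qed
  ultimately have "closed {s :: state. \<forall>n. at_level n (snd (snd s)) \<longrightarrow>
      (fst s, \<lambda>i. snd (snd s) (n + 1 + i)) \<in> P \<and> fst (snd s) = rev_prefix n (snd (snd s))}"
    by (intro closed_Collect_all closed_Collect_imp closed_Collect_conj)
  then show ?thesis by (simp add: regular_states_def case_prod_beta')
qed

lemma compact_states: "closed P \<Longrightarrow> compact (insert root_state (regular_states P))"
  using compact_Int_closed[OF compact_UNIV_state closed_regular_states]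
  by (simp add: compact_insert)

section \<open>Backward orbits of the root\<close>

lemma regular_statesD:
  assumes "(y, p, v) \<in> regular_states P" "at_level n v"
  shows "(y, \<lambda>i. v (n + 1 + i)) \<in> P" "p = rev_prefix n v"
  using assms unfolding regular_states_def by auto

text \<open>The value does not come from the branch \<open>v 0 0\<close> of \<open>step\<close>: the
  zero state has no level, and the root has the bit \<open>p n 0\<close>. So \<open>step\<close>
  acted as a shift.\<close>

lemma step_eq_at_level:
  assumes "step s = (y, p, v)" "at_level n v" "\<not> p n 0"
    and "s \<in> insert root_state (regular_states P)"
  obtains p' v' where "s = (y, p', v')" "s \<in> regular_states P" "at_level (Suc n) v'"
    "\<And>i. v' (Suc i) = v i"
proof -
  obtain y' p' v' where s: "s = (y', p', v')" by (cases s)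
  have "\<not> v' 0 0"
    using assms(1-3) by (auto simp: s step_def root_state_def at_level_def split: if_splits)
  then have *: "y' = y" "v = (\<lambda>i. v' (Suc i))"
    using assms(1) by (auto simp: s step_def)
  have "at_level (Suc n) v'"
    using assms(2) \<open>\<not> v' 0 0\<close> by (auto simp: at_level_def * less_Suc_eq_0_disj)
  moreover have "s \<noteq> root_state" using \<open>\<not> v' 0 0\<close> by (auto simp: s root_state_def)
  ultimately show ?thesis using that[of p' v'] assms(4) s * by simp
qed

text \<open>The root goes to the zero state, and a shift cannot produce the root, because the
  history of a state of level 1 is too short.\<close>

lemma step_eq_root:
  assumes "step s = root_state" "s \<in> insert root_state (regular_states P)"
  obtains y p v where "s = (y, p, v)" "s \<in> regular_states P" "at_level 0 v"
proof -
  obtain y p v where s: "s = (y, p, v)" by (cases s)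
  have "s \<noteq> root_state" using assms(1) by (auto simp: step_def root_state_def fun_eq_iff)
  then have reg: "s \<in> regular_states P" using assms(2) by simp
  have "v 0 0"
  proof (rule ccontr)
    assume "\<not> v 0 0"
    then have *: "\<And>i. p (Suc i) = (\<lambda>_. True)" "\<And>i. v (Suc i) = (\<lambda>_. True)"
      using assms(1) by (auto simp: s step_def root_state_def fun_eq_iff)
    then have "at_level 1 v" using \<open>\<not> v 0 0\<close> by (simp add: at_level_def)
    then have "p = rev_prefix 1 v" using regular_statesD(2) reg s by blast
    \<comment> \<open>At level 1 only row 0 of the history is filled.\<close>
    then have "p (Suc 0) = (\<lambda>_. False)" by (simp add: rev_prefix_def)
    then show False using *(1)[of 0] by (simp add: fun_eq_iff)
  qed
  then show ?thesis using that s reg by (simp add: at_level_def)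
qed

text \<open>Along the orbit \<open>y\<close> and \<open>z\<close> stay fixed, and the newest history
  row is the row of \<open>z\<close> just read. The target has a full row there, so each column
  meets a one at some time; a subsequence gives no more than that.\<close>

lemma target_in_special_alpha_limitD:
  assumes "target y \<in> special_alpha_limit (insert root_state (regular_states P)) step root_state"
  obtains z where "(y, z) \<in> P" "\<And>j. \<exists>m. z m j"
proof -
  obtain xs r where xs: "\<And>n. xs n \<in> insert root_state (regular_states P)" "xs 0 = root_state"
      "\<And>n. step (xs (Suc n)) = xs n"
    and r: "strict_mono r" "(xs \<circ> r) \<longlonglongrightarrow> target y"
    using assms unfolding special_alpha_limit_def alpha_limit_def backward_orbit_def by blast
  obtain y' p0 v0 where base: "xs (Suc 0) = (y', p0, v0)" "xs (Suc 0) \<in> regular_states P" "at_level 0 v0"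
    using step_eq_root[of "xs (Suc 0)" P] xs(1)[of "Suc 0"] xs(2) xs(3)[of 0] by metis
  define z where "z i = v0 (Suc i)" for i
  have lev: "\<exists>p v. xs (Suc n) = (y', p, v) \<and> xs (Suc n) \<in> regular_states P \<and> at_level n v
      \<and> (\<forall>i. v (n + 1 + i) = z i)" for n
  proof (induction n)
    case 0
    then show ?case using base by (simp add: z_def)
  next
    case (Suc n)
    then obtain p v where pv: "xs (Suc n) = (y', p, v)" "xs (Suc n) \<in> regular_states P"
      "at_level n v" "\<And>i. v (n + 1 + i) = z i" by blast
    have "p = rev_prefix n v"
      by (rule regular_statesD(2)[OF _ pv(3)]) (use pv(1,2) in simp)
    then have "\<not> p n 0" by (simp add: rev_prefix_def)
    moreover have "step (xs (Suc (Suc n))) = (y', p, v)"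
      using xs(3)[of "Suc n"] pv(1) by simp
    ultimately obtain p' v'
      where "xs (Suc (Suc n)) = (y', p', v')" "xs (Suc (Suc n)) \<in> regular_states P"
        "at_level (Suc n) v'" "\<And>i. v' (Suc i) = v i"
      using step_eq_at_level[OF _ pv(3) _ xs(1)[of "Suc (Suc n)"]] by blast
    then show ?case using pv(4) by simp
  qed
  have hd: "fst (snd (xs (Suc (Suc n)))) 0 = z n" and fst_xs: "fst (xs (Suc n)) = y'" for n
  proof -
    obtain p v where pv: "xs (Suc (Suc n)) = (y', p, v)" "xs (Suc (Suc n)) \<in> regular_states P"
      "at_level (Suc n) v" "\<And>i. v (Suc n + 1 + i) = z i" using lev by blast
    have "p = rev_prefix (Suc n) v"
      by (rule regular_statesD(2)[OF _ pv(3)]) (use pv(1,2) in simp)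
    then have "p 0 = v (2 * Suc n)" by (simp add: rev_prefix_def)
    \<comment> \<open>\<open>2 * Suc n\<close> is \<open>Suc n + 1 + n\<close>, the place of row
      \<open>n\<close> of \<open>z\<close> at level \<open>Suc n\<close>.\<close>
    also have "\<dots> = z n" using pv(4)[of n] by (simp add: mult_2)
    finally show "fst (snd (xs (Suc (Suc n)))) 0 = z n" by (simp add: pv(1))
    show "fst (xs (Suc n)) = y'" using lev[of n] by auto
  qed
  \<comment> \<open>Index 0 is the root and index 1 has level 0; a row has been read only from index
    2 on.\<close>
  have r_large: "\<forall>\<^sub>F n in sequentially. r n \<ge> 2"
    using seq_suble[OF r(1)] by (metis eventually_at_top_linorderI le_trans)
  have "y' i = y i" for i
  proof -
    have "(\<lambda>n. fst ((xs \<circ> r) n) i) \<longlonglongrightarrow> y i"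
      using tendsto_fun_apply[OF tendsto_fst[OF r(2)]] by (simp add: target_def)
    then have "\<forall>\<^sub>F n in sequentially. fst (xs (r n)) i = y i"
      by (simp add: tendsto_discrete)
    then obtain n where n: "fst (xs (r n)) i = y i" "r n \<ge> 2"
      using eventually_happens'[OF sequentially_bot eventually_conj[OF _ r_large]] by blast
    then obtain m where "r n = Suc m" by (cases "r n") auto
    then show ?thesis using n(1) fst_xs[of m] by simp
  qed
  then have "y' = y" by auto
  have "\<exists>m. z m j" for j
  proof -
    have "(\<lambda>n. fst (snd ((xs \<circ> r) n)) 0 j) \<longlonglongrightarrow> True"
      using tendsto_fun_apply[OF tendsto_fun_apply[OF tendsto_fst[OF tendsto_snd[OF r(2)]]], of 0 j]
      by (simp add: target_def)
    then have "\<forall>\<^sub>F n in sequentially. fst (snd (xs (r n))) 0 j"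
      by (simp add: tendsto_discrete)
    then obtain n where n: "fst (snd (xs (r n))) 0 j" "r n \<ge> 2"
      using eventually_happens'[OF sequentially_bot eventually_conj[OF _ r_large]] by blast
    then obtain m where "r n = Suc (Suc m)" by (metis add_2_eq_Suc le_Suc_ex)
    then show ?thesis using n(1) hd[of m] by metis
  qed
  moreover have "(y, z) \<in> P"
    using regular_statesD(1)[of y' p0 v0 P 0] base \<open>y' = y\<close> by (simp add: z_def[abs_def])
  ultimately show ?thesis using that by blast
qed

text \<open>For fixed \<open>i\<close> the history row \<open>z (n - 1 - i)\<close> moves
  arbitrarily far down \<open>z\<close> as \<open>n\<close> grows, so each of its bits becomes
  one.\<close>

lemma target_in_special_alpha_limitI:
  assumes P: "(y, z) \<in> P" and z: "\<And>j. \<forall>\<^sub>F m in sequentially. z m j"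
  shows "target y \<in> special_alpha_limit (insert root_state (regular_states P)) step root_state"
proof -
  define p where "p n i = (if i < n then z (n - 1 - i) else (\<lambda>_. False))" for n i
  \<comment> \<open>The first \<open>n\<close> rows vanish in every column, although the level
    constrains column 0 only; this makes \<open>v n\<close> tend to zero.\<close>
  define v where "v n i = (if i < n then (\<lambda>_. False) else if i = n then (\<lambda>_. True)
    else z (i - (n + 1)))" for n i :: nat
  define xs where "xs = case_nat root_state (\<lambda>n. (y, p n, v n))"
  have level: "at_level m (v n) \<longleftrightarrow> m = n" for m n
    by (cases m n rule: linorder_cases) (auto simp: at_level_def v_def)
  have "p n = rev_prefix n (v n)" for n
    by (rule ext) (auto simp: p_def rev_prefix_def v_def intro!: arg_cong[of _ _ z])
  then have "(y, p n, v n) \<in> regular_states P" for n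
    using P by (simp add: regular_states_def level) (simp add: v_def)
  then have "xs n \<in> insert root_state (regular_states P)" for n
    by (cases n) (simp_all add: xs_def)
  moreover have "step (xs (Suc n)) = xs n" for n
    by (cases n) (auto simp: xs_def step_def p_def v_def fun_eq_iff)
  ultimately have "backward_orbit (insert root_state (regular_states P)) step root_state xs"
    by (simp add: backward_orbit_def xs_def)
  moreover have "(xs \<circ> id) \<longlonglongrightarrow> target y"
  proof -
    have "(\<lambda>n. p n i j) \<longlonglongrightarrow> True" for i j
    proof -
      obtain N where N: "\<And>m. m \<ge> N \<Longrightarrow> z m j"
        using z[of j] by (auto simp: eventually_sequentially)
      show ?thesis
        unfolding tendsto_discrete eventually_sequentially
        by (intro exI[of _ "N + i + 1"]) (auto simp: p_def intro!: N)
    qed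
    then have "p \<longlonglongrightarrow> (\<lambda>_ _. True)" by (intro tendsto_fun)
    moreover have "(\<lambda>n. v n i j) \<longlonglongrightarrow> False" for i j
      unfolding tendsto_discrete eventually_sequentially
      by (intro exI[of _ "Suc i"]) (auto simp: v_def)
    then have "v \<longlonglongrightarrow> (\<lambda>_ _. False)" by (intro tendsto_fun)
    ultimately have "(\<lambda>n. (y, p n, v n)) \<longlonglongrightarrow> target y"
      unfolding target_def by (intro tendsto_Pair tendsto_const)
    then have "(\<lambda>n. xs (Suc n)) \<longlonglongrightarrow> target y" by (simp add: xs_def)
    then have "xs \<longlonglongrightarrow> target y" by (rule LIMSEQ_imp_Suc)
    then show ?thesis by simp
  qed
  moreover have "target y \<in> regular_states P"
    by (simp add: target_def regular_states_def at_level_def)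
  ultimately show ?thesis
    unfolding special_alpha_limit_def alpha_limit_def using strict_mono_id by blast
qed

text \<open>Column \<open>j\<close> codes a natural number by the position of its first one.
  Decoding is continuous only on the set \<open>S\<close> where every column has a one, so the
  preimage of \<open>Q\<close> is closed relative to \<open>S\<close> and \<open>P\<close> is a
  closed set with that trace.\<close>

lemma closed_set_Cantor_coding:
  fixes Q :: "((nat \<Rightarrow> bool) \<times> (nat \<Rightarrow> nat)) set"
  assumes Q: "closed Q"
  obtains P :: "((nat \<Rightarrow> bool) \<times> (nat \<Rightarrow> nat \<Rightarrow> bool)) set"
  where "closed P" "\<And>y z. (\<And>j. \<exists>m. z m j) \<Longrightarrow> (y, z) \<in> P \<longleftrightarrow> (y, \<lambda>j. LEAST m. z m j) \<in> Q"
proof -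
  define S :: "((nat \<Rightarrow> bool) \<times> (nat \<Rightarrow> nat \<Rightarrow> bool)) set"
    where "S = {q. \<forall>j. \<exists>m. snd q m j}"
  have LEAST: "continuous_on S (\<lambda>q. LEAST m. snd q m j)" for j
  proof -
    define A where "A k = {q :: (nat \<Rightarrow> bool) \<times> (nat \<Rightarrow> nat \<Rightarrow> bool). snd q k j}
        \<inter> (\<Inter>m\<in>{..<k}. {q. \<not> snd q m j})" for k
    have "continuous_on UNIV (\<lambda>q :: (nat \<Rightarrow> bool) \<times> (nat \<Rightarrow> nat \<Rightarrow> bool). snd q k j)" for k
      by (rule continuous_on_product_then_coordinatewise[OF continuous_on_snd_apply])
    note * = clopen_Collect_bool[OF this]
    have "open (A k)" for k
      unfolding A_def using * by (intro open_Int open_INT ballI) (simp_all add: open_Collect_neg)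
    moreover have "q \<in> A k \<longleftrightarrow> (LEAST m. snd q m j) = k" if "q \<in> S" for q k
    proof -
      have "\<exists>m. snd q m j" using that by (simp add: S_def)
      then have "snd q (LEAST m. snd q m j) j" by (rule LeastI_ex)
      then show ?thesis
        by (auto simp: A_def intro!: Least_equality dest: not_less_Least)
    qed
    ultimately show ?thesis
      unfolding continuous_on_open_invariant
      by (intro allI impI, rule_tac x="\<Union>k\<in>B. A k" in exI) auto
  qed
  have "closedin (top_of_set S) (S \<inter> (\<lambda>q. (fst q, \<lambda>j. LEAST m. snd q m j)) -` Q)"
    by (rule continuous_closedin_preimage[OF _ Q],
        rule continuous_on_Pair[OF continuous_on_fst[OF continuous_on_id]],
        rule continuous_on_coordinatewise_then_product, rule LEAST)
  then obtain P where P: "closed P" "S \<inter> (\<lambda>q. (fst q, \<lambda>j. LEAST m. snd q m j)) -` Q = S \<inter> P"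
    unfolding closedin_closed by blast
  have "(y, z) \<in> P \<longleftrightarrow> (y, \<lambda>j. LEAST m. z m j) \<in> Q" if "\<And>j. \<exists>m. z m j" for y z
  proof -
    have "(y, z) \<in> S" using that by (simp add: S_def)
    moreover have "(y, z) \<in> S \<inter> (\<lambda>q. (fst q, \<lambda>j. LEAST m. snd q m j)) -` Q
        \<longleftrightarrow> (y, z) \<in> S \<inter> P"
      by (simp only: P(2))
    ultimately show ?thesis by simp
  qed
  with P(1) show ?thesis using that by blast
qed

section \<open>Embedding into the line\<close>

text \<open>In base 3 with digits 0 and 1, all later digits together weigh half as much as one
  digit, so expansions are unique.\<close>

definition cantor :: "(nat \<Rightarrow> bool) \<Rightarrow> real" where
  "cantor s = (\<Sum>n. of_bool (s n) * (1 / 3) ^ Suc n)"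

lemma summable_third: "summable (\<lambda>n. (1 / 3 :: real) ^ Suc n)"
  by (subst summable_Suc_iff) (simp add: summable_geometric)

lemma suminf_third: "(\<Sum>n. (1 / 3 :: real) ^ Suc n) = 1 / 2"
proof -
  have "(\<lambda>n. (1 / 3 :: real) * (1 / 3) ^ n) sums (1 / 3 * (1 / (1 - 1 / 3)))"
    by (intro sums_mult geometric_sums) simp
  then show ?thesis by (simp add: sums_iff)
qed

lemma summable_cantor: "summable (\<lambda>n. of_bool (s n) * (1 / 3 :: real) ^ Suc n)"
  by (rule summable_comparison_test'[OF summable_third, of 0]) auto

lemma cantor_nonneg: "0 \<le> cantor s"
  unfolding cantor_def by (rule suminf_nonneg[OF summable_cantor]) auto

lemma cantor_le_half: "cantor s \<le> 1 / 2"
proof -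
  have "cantor s \<le> (\<Sum>n. (1 / 3) ^ Suc n)"
    unfolding cantor_def by (rule suminf_le[OF _ summable_cantor summable_third]) simp
  then show ?thesis by (simp only: suminf_third)
qed

lemma cantor_rec: "cantor s = (of_bool (s 0) + cantor (\<lambda>n. s (Suc n))) / 3"
proof -
  have "cantor s = of_bool (s 0) * (1 / 3) + (\<Sum>n. of_bool (s (Suc n)) * (1 / 3) ^ Suc (Suc n))"
    unfolding cantor_def using suminf_split_head[OF summable_cantor[of s]] by simp
  also have "(\<Sum>n. of_bool (s (Suc n)) * (1 / 3 :: real) ^ Suc (Suc n))
      = 1 / 3 * cantor (\<lambda>n. s (Suc n))"
    unfolding cantor_def
    by (subst suminf_mult[symmetric, OF summable_cantor]) (simp add: mult_ac)
  finally show ?thesis by simp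
qed

lemma cantor_eq_imp_hd:
  assumes "cantor s = cantor s'"
  shows "s 0 = s' 0"
proof -
  have "of_bool (s 0) + cantor (\<lambda>n. s (Suc n)) = of_bool (s' 0) + cantor (\<lambda>n. s' (Suc n))"
    using assms cantor_rec[of s] cantor_rec[of s'] by simp
  \<comment> \<open>The tails lie between 0 and 1 / 2, so they cannot offset a difference in the
    leading digit.\<close>
  then have "\<bar>of_bool (s 0) - of_bool (s' 0) :: real\<bar> < 1"
    using cantor_nonneg[of "\<lambda>n. s (Suc n)"] cantor_le_half[of "\<lambda>n. s (Suc n)"]
      cantor_nonneg[of "\<lambda>n. s' (Suc n)"] cantor_le_half[of "\<lambda>n. s' (Suc n)"] by linarith
  then show ?thesis by (cases "s 0"; cases "s' 0") simp_all
qed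

lemma inj_cantor: "inj cantor"
proof (intro injI ext)
  fix s s' n assume "cantor s = cantor s'"
  then show "s n = s' n"
  proof (induction n arbitrary: s s')
    case 0
    then show ?case by (rule cantor_eq_imp_hd)
  next
    case (Suc n)
    have "s 0 = s' 0" by (rule cantor_eq_imp_hd[OF Suc.prems])
    then have "cantor (\<lambda>n. s (Suc n)) = cantor (\<lambda>n. s' (Suc n))"
      using Suc.prems cantor_rec[of s] cantor_rec[of s'] by simp
    then show ?case by (rule Suc.IH)
  qed
qed

lemma continuous_on_cantor: "continuous_on UNIV cantor"
proof (rule uniform_limit_theorem)
  show "uniform_limit UNIV (\<lambda>n s. \<Sum>i<n. of_bool (s i) * (1 / 3) ^ Suc i) cantor sequentially"
    unfolding cantor_def[abs_def]
    by (rule Weierstrass_m_test[OF _ summable_third]) auto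
  have "continuous_on UNIV (\<lambda>s :: nat \<Rightarrow> bool. of_bool (s i) :: real)" for i
    by (rule continuous_on_compose2[of UNIV of_bool])
      (auto intro: continuous_on_discrete continuous_on_product_coordinates)
  then show "\<forall>\<^sub>F n in sequentially. continuous_on UNIV
      (\<lambda>s. \<Sum>i<n. of_bool (s i) * (1 / 3 :: real) ^ Suc i)"
    by (intro always_eventually allI continuous_on_sum continuous_on_mult_right)
qed simp


text \<open>The tag \<open>c\<close> selects the component; tags above 1 all repeat the third one,
  which keeps the function total.\<close>

definition flatten :: "state \<Rightarrow> nat \<Rightarrow> bool" where
  "flatten s n = (let (c, k) = prod_decode n; (i, j) = prod_decode k in
     if c = 0 then fst s k else if c = 1 then fst (snd s) i j else snd (snd s) i j)"

lemma inj_flatten: "inj flatten"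
proof (rule injI)
  fix s s' assume *: "flatten s = flatten s'"
  have "fst s k = fst s' k" for k
    using fun_cong[OF *, of "prod_encode (0, k)"] by (simp add: flatten_def case_prod_beta')
  moreover have "fst (snd s) i j = fst (snd s') i j" for i j
    using fun_cong[OF *, of "prod_encode (1, prod_encode (i, j))"] by (simp add: flatten_def)
  moreover have "snd (snd s) i j = snd (snd s') i j" for i j
    using fun_cong[OF *, of "prod_encode (2, prod_encode (i, j))"] by (simp add: flatten_def)
  ultimately show "s = s'" by (simp add: prod_eq_iff fun_eq_iff)
qed

lemma continuous_on_flatten: "continuous_on UNIV flatten"
proof (rule continuous_on_coordinatewise_then_product)
  fix n
  obtain c k where ck: "prod_decode n = (c, k)" by fastforce
  obtain i j where ij: "prod_decode k = (i, j)" by fastforce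
  consider "c = 0" | "c = 1" | "c \<noteq> 0" "c \<noteq> 1" by blast
  then show "continuous_on UNIV (\<lambda>s. flatten s n)"
    by cases (simp_all add: flatten_def ck ij continuous_on_state_coordinates)
qed

definition embed :: "state \<Rightarrow> real" where
  "embed s = cantor (flatten s)"

lemma inj_embed: "inj embed"
  using inj_compose[OF inj_cantor inj_flatten] by (simp add: embed_def[abs_def] o_def)

lemma continuous_on_embed: "continuous_on UNIV embed"
  unfolding embed_def[abs_def]
  by (rule continuous_on_compose2[OF continuous_on_cantor continuous_on_flatten]) simp

lemma embed_in_unit: "embed s \<in> {0..1}"
  using cantor_nonneg[of "flatten s"] cantor_le_half[of "flatten s"] by (simp add: embed_def)


section \<open>The main result\<close>

text \<open>Complements are relative to \<open>topspace X\<close>; as \<open>h\<close> takes all its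
  values there, preimages turn them into absolute complements.\<close>

lemma borel_in_vimage:
  assumes "borel_in X S" and h: "continuous_map euclidean X h"
  shows "h -` S \<in> sets borel"
proof -
  have top: "h x \<in> topspace X" for x
    using continuous_map_image_subset_topspace[OF h] by auto
  have "S \<in> sigma_sets (topspace X) {U. openin X U}"
    using assms(1) by (simp add: borel_in_def)
  then show ?thesis
  proof induction
    case (Basic U)
    then have "open (h -` U)"
      using openin_continuous_map_preimage[OF h, of U] by (simp add: vimage_def)
    then show ?case by simp
  next
    case (Compl S)
    have "h -` (topspace X - S) = - (h -` S)" using top by auto
    then show ?case using Compl.IH by simp
  qed (auto simp: vimage_UN)
qed

theorem theorem5:
  shows "\<exists>(F :: real \<times> real \<Rightarrow> real \<times> real) x0.
           continuous_on unit_square F \<and> F ` unit_square = unit_square \<and>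
           x0 \<in> unit_square \<and>
           Sigma11_complete_in (top_of_set unit_square) (special_alpha_limit unit_square F x0)"
proof -
  obtain Q :: "((nat \<Rightarrow> bool) \<times> (nat \<Rightarrow> nat)) set"
    where Q: "closed Q" "fst ` Q \<notin> sets borel"
    by (rule closed_with_non_borel_projection)
  obtain P :: "((nat \<Rightarrow> bool) \<times> (nat \<Rightarrow> nat \<Rightarrow> bool)) set" where P: "closed P"
    "\<And>y z. (\<And>j. \<exists>m. z m j) \<Longrightarrow> (y, z) \<in> P \<longleftrightarrow> (y, \<lambda>j. LEAST m. z m j) \<in> Q"
    by (rule closed_set_Cantor_coding[OF Q(1)]) blast
  define X where "X = insert root_state (regular_states P)"
  define g where "g = embed \<circ> step \<circ> inv embed"
  have "compact X"
    unfolding X_def by (rule compact_states[OF P(1)])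
  then have K: "compact (embed ` X)"
    by (rule compact_continuous_image[OF continuous_on_subset[OF continuous_on_embed subset_UNIV]])
  have K': "embed ` X \<noteq> {}" "embed ` X \<subseteq> {0..1}"
    using embed_in_unit by (auto simp: X_def simp del: atLeastAtMost_iff)
  have "continuous_on (range embed) (inv embed)"
    by (rule continuous_on_inv[OF continuous_on_embed compact_UNIV_state])
      (simp add: inj_embed)
  then have "continuous_on (embed ` X) (inv embed)"
    by (rule continuous_on_subset) auto
  then have g_cont: "continuous_on (embed ` X) g"
    unfolding g_def
    by (intro continuous_on_compose) (auto intro: continuous_on_subset[OF continuous_on_step]
        continuous_on_subset[OF continuous_on_embed])
  have g_range: "g ` embed ` X \<subseteq> {0..1}"
    unfolding g_def by (intro image_subsetI) (simp only: comp_apply embed_in_unit)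
  obtain F where F: "continuous_on unit_square F" "F ` unit_square = unit_square"
    "\<And>x z. x \<in> embed ` X \<Longrightarrow> (z, 0) \<in> special_alpha_limit unit_square F (x, 0)
      \<longleftrightarrow> z \<in> special_alpha_limit (embed ` X) g x"
    by (rule planar_extension[OF K K' g_cont g_range]) blast
  define S where "S = special_alpha_limit unit_square F (embed root_state, 0)"
  \<comment> \<open>Along this continuous map into the bottom side, \<open>S\<close> will pull back
    to the projection of \<open>Q\<close>.\<close>
  define h where "h y = (embed (target y), 0 :: real)" for y
  have "h y \<in> S \<longleftrightarrow> target y \<in> special_alpha_limit X step root_state" for y
    unfolding S_def h_def g_def[symmetric]
      special_alpha_limit_image[OF continuous_on_embed inj_embed compact_UNIV_state,
        of _ X step root_state, symmetric]
    by (rule F(3)) (simp add: X_def)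
  moreover have "target y \<in> special_alpha_limit X step root_state \<longleftrightarrow> y \<in> fst ` Q" for y
  proof
    assume "target y \<in> special_alpha_limit X step root_state"
    then obtain z where z: "(y, z) \<in> P" "\<And>j. \<exists>m. z m j"
      unfolding X_def by (rule target_in_special_alpha_limitD) blast
    then have "(y, \<lambda>j. LEAST m. z m j) \<in> Q" using P(2)[OF z(2)] by simp
    then show "y \<in> fst ` Q" by (rule rev_image_eqI) simp
  next
    assume "y \<in> fst ` Q"
    then obtain a where a: "(y, a) \<in> Q" by auto
    \<comment> \<open>The first one of column \<open>j\<close> stands at \<open>a j\<close>, as the
      coding asks, and only ones follow, as convergence to the target asks.\<close>
    define z where "z m j \<longleftrightarrow> a j \<le> m" for m j
    have "(LEAST m. z m j) = a j" for j
      by (rule Least_equality) (auto simp: z_def)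
    moreover have "\<exists>m. z m j" for j by (auto simp: z_def)
    ultimately have "(y, z) \<in> P" using P(2)[of z y] a by simp
    then show "target y \<in> special_alpha_limit X step root_state"
      unfolding X_def
      by (rule target_in_special_alpha_limitI) (auto simp: z_def eventually_ge_at_top)
  qed
  ultimately have "h -` S = fst ` Q" by (intro set_eqI) (simp only: vimage_eq)
  moreover have "continuous_map euclidean (top_of_set unit_square) h"
  proof -
    have "continuous_on UNIV target"
      unfolding target_def[abs_def]
      by (intro continuous_on_Pair continuous_on_const continuous_on_id)
    then have "continuous_on UNIV h"
      unfolding h_def[abs_def]
      by (intro continuous_on_Pair continuous_on_const continuous_on_compose2[OF continuous_on_embed])
        simp_all
    then show ?thesis
      using embed_in_unit by (auto simp: continuous_map_in_subtopology h_def)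
  qed
  ultimately have "\<not> borel_in (top_of_set unit_square) S"
    using borel_in_vimage Q(2) by metis
  moreover have "analytic_in (top_of_set unit_square) S"
    unfolding S_def by (rule analytic_special_alpha_limit[OF F(1)])
  ultimately have "Sigma11_complete_in (top_of_set unit_square) S"
    by (simp add: Sigma11_complete_in_def)
  moreover have "(embed root_state, 0) \<in> unit_square"
    using embed_in_unit[of root_state] by simp
  ultimately show ?thesis
    using F(1,2) unfolding S_def by blast
qed

end
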